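(* Let $a>0$ and $n\ge1$. The roots of the Charlier polynomial $C_n(x;a)$ are real, simple, located in $(0,+\infty)$, have mutual distances greater than $1$, and form the equilibrium distribution of $n$ charges in $(0,+\infty)$, with exclusion radius $h=1$, under the external field $\phi^C$ with force $$F_{\phi^C}(x)=-(\phi^C)'(x)=\frac12\log\left(\frac{a}{x}\right),\qquad x\in(0,+\infty).$$
   Context: Charlier polynomials: $C_n(x;a)=\sum_{k=0}^n\frac{(-n)_k(-x)_k}{k!}\left(\frac{-1}{a}\right)^k$, where $(u)_k=u(u+1)\cdots(u+k-1)$ is the Pochhammer symbol. They are orthogonal with respect to the discrete measure $\sum_{j=0}^\infty\frac{a^j}{j!}\delta_j$. Equilibrium distribution with $h=1$: the unit-charge potential is $V_x(y)=\frac{x-y}{2}\log\left(\frac{y-x+1}{y-x-1}\right)-\frac12\log\big((y-x+1)(y-x-1)\big)$ for $|y-x|>1$, the energy is $\mathcal{E}_\phi(x_1,\dots,x_n)=\sum_{j\neq k}V_{x_k}(x_j)+2\sum_{j=1}^n\phi(x_j)$, and an equilibrium distribution of $n$ charges in $(\alpha,\beta)$ is a distribution $x_1<\dots<x_n$ with $x_{j+1}>x_j+1$ that minimizes $\mathcal{E}_\phi$ among all distributions of $n$ points in $(\alpha,\beta)$ with mutual distances greater than $1$. *)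

theory Defs
  imports Complex_Main "HOL-Computational_Algebra.Polynomial"
begin

definition charlier :: "nat \<Rightarrow> real \<Rightarrow> real poly" where
  "charlier n a =
     (\<Sum>k\<le>n. smult (pochhammer (- real n) k / fact k * (- 1 / a) ^ k)
                  (pochhammer (- [:0, 1:]) k))"

lemma poly_pochhammer:
  fixes p :: "'a::comm_ring_1 poly"
  shows "poly (pochhammer p k) x = pochhammer (poly p x) k"
  by (simp add: pochhammer_prod poly_prod)

lemma poly_charlier:
  "poly (charlier n a) x =
     (\<Sum>k = 0..n. pochhammer (- real n) k * pochhammer (- x) k / fact k * (- 1 / a) ^ k)"
  by (simp add: charlier_def poly_sum poly_pochhammer atLeast0AtMost mult_ac)

text \<open>Only the values with \<open>\<bar>y - x\<bar> > 1\<close> are meaningful; there both logarithms have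
  positive arguments. The exclusion radius is \<open>h = 1\<close> throughout.\<close>

definition unit_potential :: "real \<Rightarrow> real \<Rightarrow> real" where
  "unit_potential x y =
     (x - y) / 2 * ln ((y - x + 1) / (y - x - 1)) - 1 / 2 * ln ((y - x + 1) * (y - x - 1))"

text \<open>A distribution of \<open>n\<close> charges is a list of length \<open>n\<close>.\<close>

definition energy :: "(real \<Rightarrow> real) \<Rightarrow> real list \<Rightarrow> real" where
  "energy \<phi> xs =
     (\<Sum>(j, k) \<in> {(j, k). j < length xs \<and> k < length xs \<and> j \<noteq> k}.
        unit_potential (xs ! k) (xs ! j))
     + 2 * (\<Sum>j<length xs. \<phi> (xs ! j))"

definition admissible :: "real set \<Rightarrow> nat \<Rightarrow> real list \<Rightarrow> bool" where
  "admissible I n xs \<longleftrightarrow>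
     length xs = n \<and> set xs \<subseteq> I \<and>
     (\<forall>j<n. \<forall>k<n. j \<noteq> k \<longrightarrow> \<bar>xs ! j - xs ! k\<bar> > 1)"

definition equilibrium_distribution ::
    "(real \<Rightarrow> real) \<Rightarrow> real set \<Rightarrow> nat \<Rightarrow> real list \<Rightarrow> bool" where
  "equilibrium_distribution \<phi> I n xs \<longleftrightarrow>
     admissible I n xs \<and>
     (\<forall>j. Suc j < n \<longrightarrow> xs ! Suc j > xs ! j + 1) \<and>
     (\<forall>ys. admissible I n ys \<longrightarrow> energy \<phi> xs \<le> energy \<phi> ys)"

end

(*
  The roots.  The backward shift C_(n+1)(x) = C_n(x) - (x/a) C_n(x-1) allows an induction that
  yields the separation of the roots along with their reality.  If x_1 < ... < x_n are the roots
  of C_n, with gaps greater than 1, then C_(n+1) changes sign on (0, x_1), on each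
  (x_j + 1, x_(j+1)), and on (x_n + 1, infinity).  Its n+1 roots, one from each of these
  intervals, are again more than 1 apart.

  The equilibrium.  At a root x_j of C_n the difference equation reads
  a C_n(x_j + 1) + x_j C_n(x_j - 1) = 0, and its logarithm is the vanishing of the gradient of
  the energy.  On ordered configurations with gaps greater than 1 the energy is strictly
  convex, so this critical point is the unique minimizer.
*)
theory Submission
  imports Defs
begin

section \<open>Difference relations\<close>

lemma pochhammer_neg_nat_over_fact:
  "pochhammer (- real n) k / fact k = (- 1) ^ k * real (n choose k)"
proof -
  have "(-1) ^ k * (real n gchoose k) = (-1) ^ k * (-1) ^ k * (pochhammer (- real n) k / fact k)"
    by (simp add: gbinomial_pochhammer)
  also have "(-1) ^ k * (-1) ^ k = (1::real)"
    by (simp flip: power_add)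
  finally show ?thesis
    by (simp add: binomial_gbinomial)
qed

text \<open>The signs of \<open>pochhammer (- real n) k\<close> and of \<open>(- 1 / a) ^ k\<close>
  cancel. Terms with k > n vanish, so the bound \<open>N\<close> is free and neighbouring degrees
  can be summed over one common range.\<close>

lemma poly_charlier_binomial:
  assumes "n \<le> N"
  shows "poly (charlier n a) x = (\<Sum>k\<le>N. real (n choose k) * pochhammer (- x) k * (1 / a) ^ k)"
proof -
  have "poly (charlier n a) x = (\<Sum>k\<le>n. real (n choose k) * pochhammer (- x) k * (1 / a) ^ k)"
    unfolding poly_charlier atLeast0AtMost
  proof (rule sum.cong)
    fix k
    have "pochhammer (- real n) k * pochhammer (- x) k / fact k * (- 1 / a) ^ k
        = (pochhammer (- real n) k / fact k) * pochhammer (- x) k * ((-1) ^ k * (1 / a) ^ k)"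
      by (simp flip: power_mult_distrib)
    also have "\<dots> = ((-1) ^ k * (-1) ^ k) * real (n choose k) * pochhammer (- x) k * (1 / a) ^ k"
      unfolding pochhammer_neg_nat_over_fact by simp
    also have "(-1) ^ k * (-1) ^ k = (1::real)"
      by (simp flip: power_add)
    finally show "pochhammer (- real n) k * pochhammer (- x) k / fact k * (- 1 / a) ^ k
        = real (n choose k) * pochhammer (- x) k * (1 / a) ^ k"
      by simp
  qed simp
  also have "\<dots> = (\<Sum>k\<le>N. real (n choose k) * pochhammer (- x) k * (1 / a) ^ k)"
    using assms by (intro sum.mono_neutral_left) auto
  finally show ?thesis .
qed

text \<open>Pascal's rule splits the sum for n + 1 in two. One half is C_n(x); in the other,
  \<open>pochhammer (- x) (Suc k)\<close> releases a factor -x and leaves the Pochhammer symbol at x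
  - 1.\<close>

lemma charlier_backward_shift:
  "poly (charlier (Suc n) a) x = poly (charlier n a) x - x / a * poly (charlier n a) (x - 1)"
proof -
  let ?t = "\<lambda>k. real (n choose k) * pochhammer (- x) (Suc k) * (1 / a) ^ Suc k"
  have "poly (charlier (Suc n) a) x
      = 1 + (\<Sum>k\<le>n. real (Suc n choose Suc k) * pochhammer (- x) (Suc k) * (1 / a) ^ Suc k)"
    by (subst poly_charlier_binomial[OF order.refl], subst sum.atMost_Suc_shift) simp
  also have "\<dots> = 1 + (\<Sum>k\<le>n. real (n choose Suc k) * pochhammer (- x) (Suc k) * (1 / a) ^ Suc k)
      + sum ?t {..n}"
    by (simp add: distrib_right sum.distrib del: power_Suc pochhammer_Suc)
  also have "1 + (\<Sum>k\<le>n. real (n choose Suc k) * pochhammer (- x) (Suc k) * (1 / a) ^ Suc k)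
      = poly (charlier n a) x"
    by (subst poly_charlier_binomial[of n "Suc n"], simp, subst sum.atMost_Suc_shift) simp
  also have "sum ?t {..n} = - (x / a) * poly (charlier n a) (x - 1)"
    unfolding poly_charlier_binomial[OF order.refl] sum_distrib_left
    by (rule sum.cong) (auto simp: pochhammer_rec)
  finally show ?thesis by simp
qed

lemma charlier_0 [simp]: "charlier 0 a = 1"
  by (simp add: charlier_def)

text \<open>Differencing the backward shift produces first differences at x and at x - 1, which the
  induction hypothesis replaces; the backward shift then reassembles the result.\<close>

lemma charlier_forward_shift:
  "poly (charlier (Suc n) a) (x + 1) - poly (charlier (Suc n) a) x
     = - (real (Suc n) / a) * poly (charlier n a) x"
proof (induction n arbitrary: x)
  case 0
  show ?case by (simp add: charlier_backward_shift diff_divide_distrib add_divide_distrib)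
next
  case (Suc n)
  let ?C = "poly (charlier (Suc n) a)"
  \<comment> \<open>The argument \<open>x - 1 + 1\<close> stays unsimplified so that the last
    bracket is an instance of the induction hypothesis.\<close>
  have "poly (charlier (Suc (Suc n)) a) (x + 1) - poly (charlier (Suc (Suc n)) a) x
      = (?C (x + 1) - ?C x) - 1 / a * ?C x - x / a * (?C (x - 1 + 1) - ?C (x - 1))"
    unfolding charlier_backward_shift[of "Suc n"]
    by (simp add: algebra_simps add_divide_distrib divide_divide_eq_left)
  also have "\<dots> = - (real (Suc n) / a) * (poly (charlier n a) x - x / a * poly (charlier n a) (x - 1))
      - 1 / a * ?C x"
    unfolding Suc.IH by (simp add: algebra_simps add_divide_distrib diff_divide_distrib)
  also have "\<dots> = - (real (Suc (Suc n)) / a) * ?C x"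
    unfolding charlier_backward_shift[of n, symmetric] by (cases "a = 0") (simp_all add: field_simps)
  finally show ?case .
qed

text \<open>C_(n-1)(x) and C_(n-1)(x - 1) are eliminated from the forward shifts at x and x - 1 and
  the backward shift at x.\<close>

lemma charlier_difference_equation:
  assumes "a \<noteq> 0"
  shows "a * poly (charlier n a) (x + 1) + x * poly (charlier n a) (x - 1)
           = (x + a - real n) * poly (charlier n a) x"
proof (cases n)
  case 0
  then show ?thesis by simp
next
  case (Suc m)
  have 1: "a * (poly (charlier n a) (x + 1) - poly (charlier n a) x) = - real n * poly (charlier m a) x"
    using charlier_forward_shift[of m a x] assms unfolding Suc by (simp add: field_simps)
  have "a * (poly (charlier n a) (x - 1 + 1) - poly (charlier n a) (x - 1))
      = - real n * poly (charlier m a) (x - 1)"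
    using charlier_forward_shift[of m a "x - 1"] assms unfolding Suc by (simp add: field_simps)
  then have "x * (a * (poly (charlier n a) x - poly (charlier n a) (x - 1)))
      = x * (- real n * poly (charlier m a) (x - 1))"
    by simp
  then have "a * (x * (poly (charlier n a) x - poly (charlier n a) (x - 1)))
      = - real n * (x * poly (charlier m a) (x - 1))"
    by (simp only: mult.left_commute)
  also have "x * poly (charlier m a) (x - 1) = a * (poly (charlier m a) x - poly (charlier n a) x)"
    using charlier_backward_shift[of m a x] assms unfolding Suc by (simp add: field_simps)
  finally have "a * (x * (poly (charlier n a) x - poly (charlier n a) (x - 1)))
      = a * (- real n * (poly (charlier m a) x - poly (charlier n a) x))"
    by (simp add: algebra_simps)
  then have "x * (poly (charlier n a) x - poly (charlier n a) (x - 1))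
      = - real n * (poly (charlier m a) x - poly (charlier n a) x)"
    using assms by (subst (asm) mult_cancel_left) simp
  with 1 show ?thesis by (simp add: algebra_simps)
qed

section \<open>Degree and leading coefficient\<close>

lemma charlier_Suc:
  "charlier (Suc n) a = charlier n a + [:0, - 1 / a:] * pcompose (charlier n a) [:- 1, 1:]"
  by (subst poly_eq_poly_eq_iff[symmetric])
    (auto simp: charlier_backward_shift poly_pcompose algebra_simps)

lemma degree_lead_coeff_charlier:
  assumes "a \<noteq> 0"
  shows "degree (charlier n a) = n \<and> lead_coeff (charlier n a) = (- 1 / a) ^ n"
proof (induction n)
  case (Suc n)
  let ?q = "[:0, - 1 / a:] * pcompose (charlier n a) [:- 1, 1:]"
  have nz: "charlier n a \<noteq> 0"
    using Suc assms by auto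
  then have nzc: "pcompose (charlier n a) [:- 1, 1:] \<noteq> 0"
    by (simp add: pcompose_eq_0_iff)
  have deg: "degree ?q = Suc n"
    using Suc nzc assms by (subst degree_mult_eq) (auto simp: degree_pcompose)
  have "lead_coeff ?q = (- 1 / a) ^ Suc n"
    using Suc assms by (subst lead_coeff_mult) (auto simp: lead_coeff_comp)
  with deg Suc show ?case
    unfolding charlier_Suc[of n] by (simp add: degree_add_eq_right coeff_eq_0)
qed simp

section \<open>The roots\<close>

text \<open>Exactly the j factors with index below j are negative at t.\<close>

lemma sign_prod_roots_minus:
  fixes x :: "nat \<Rightarrow> real"
  assumes "0 < a" "j \<le> n" "\<And>i. i < j \<Longrightarrow> x i < t" "\<And>i. j \<le> i \<Longrightarrow> i < n \<Longrightarrow> t < x i"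
  shows "0 < (- 1) ^ j * (\<Prod>i<n. (x i - t) / a)"
proof -
  have "(\<Prod>i<n. (x i - t) / a) = (\<Prod>i<j. (x i - t) / a) * (\<Prod>i=j..<n. (x i - t) / a)"
    using assms(2) by (subst prod.union_disjoint[symmetric]) (auto intro!: prod.cong)
  moreover have "(- 1) ^ j * (\<Prod>i<j. (x i - t) / a) = (\<Prod>i<j. (t - x i) / a)"
  proof -
    have "(\<Prod>i<j. (t - x i) / a) = (\<Prod>i<j. - 1 * ((x i - t) / a))"
      by (rule prod.cong) (auto simp: diff_divide_distrib)
    then show ?thesis
      by (simp only: prod.distrib prod_constant card_lessThan)
  qed
  ultimately have "(- 1) ^ j * (\<Prod>i<n. (x i - t) / a)
      = (\<Prod>i<j. (t - x i) / a) * (\<Prod>i=j..<n. (x i - t) / a)"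
    by (simp only: mult.assoc[symmetric])
  also have "\<dots> > 0"
    using assms by (intro mult_pos_pos prod_pos) auto
  finally show ?thesis .
qed

text \<open>Two polynomials of degree at most n with equal coefficients at n agree once they agree
  at n points. Writing the factors as (z_i - t)/a builds the leading coefficient
  \<open>(- 1 / a) ^ n\<close> into the product.\<close>

lemma charlier_eq_prod_roots:
  assumes "a \<noteq> 0" "inj_on z {..<n}" "\<And>i. i < n \<Longrightarrow> poly (charlier n a) (z i) = 0"
  shows "charlier n a = (\<Prod>i<n. [:z i / a, - 1 / a:])"
proof (rule poly_eqI_degree_lead_coeff[where A = "z ` {..<n}" and n = n])
  let ?P = "\<Prod>i<n. [:z i / a, - 1 / a:]"
  have deg: "degree ?P = n"
    using assms(1) by (subst degree_prod_eq_sum_degree) auto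
  have "coeff ?P n = lead_coeff ?P"
    using deg by simp
  also have "\<dots> = (- 1 / a) ^ n"
    using assms(1) by (simp add: lead_coeff_prod)
  finally show "coeff (charlier n a) n = coeff ?P n"
    using degree_lead_coeff_charlier[OF assms(1), of n] by metis
  show "degree ?P \<le> n" using deg by simp
  show "degree (charlier n a) \<le> n"
    using degree_lead_coeff_charlier[OF assms(1), of n] by simp
  show "poly (charlier n a) y = poly ?P y" if "y \<in> z ` {..<n}" for y
    using that assms(3) by (auto simp: poly_prod intro!: prod_zero[symmetric])
qed (simp add: card_image assms(2))

text \<open>The induction carries the full factorization: it says that no further roots exist, and
  it gives the sign of C_n between the roots, which the next step needs.\<close>

lemma charlier_roots:
  assumes "a > 0"
  shows "\<exists>x. (\<forall>i<n. 0 < x i) \<and> (\<forall>i j. i < j \<longrightarrow> j < n \<longrightarrow> x i + 1 < x j) \<and>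
           charlier n a = (\<Prod>i<n. [:x i / a, - 1 / a:])"
proof (induction n)
  case (Suc n)
  then obtain x where pos: "\<And>i. i < n \<Longrightarrow> 0 < x i"
    and gap: "\<And>i j. i < j \<Longrightarrow> j < n \<Longrightarrow> x i + 1 < x j"
    and p_eq: "charlier n a = (\<Prod>i<n. [:x i / a, - 1 / a:])"
    by blast
  define p where "p = poly (charlier n a)"
  define q where "q = charlier (Suc n) a"
  have p_prod: "p t = (\<Prod>i<n. (x i - t) / a)" for t
    unfolding p_def p_eq poly_prod by (simp add: diff_divide_distrib)
  have p_root: "p (x i) = 0" if "i < n" for i
    unfolding p_prod using that by (intro prod_zero) auto
  have q_eq: "poly q t = p t - t / a * p (t - 1)" for t
    unfolding p_def q_def by (rule charlier_backward_shift)
  have p_sign: "0 < (- 1) ^ j * p t"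
    if "j \<le> n" "\<And>i. i < j \<Longrightarrow> x i < t" "\<And>i. j \<le> i \<Longrightarrow> i < n \<Longrightarrow> t < x i" for j t
    unfolding p_prod by (rule sign_prod_roots_minus) (use that assms in auto)
  have gap': "x i + 1 \<le> x j + 1" if "i \<le> j" "j < n" for i j
    using that gap[of i j] by (cases "i = j") auto
  \<comment> \<open>Left endpoints of the search intervals. At 0 and at each x_i + 1 the second term
    of \<open>q_eq\<close> vanishes, so q has the sign of p there.\<close>
  define l where "l j = (if j = 0 then 0 else x (j - 1) + 1)" for j
  have l_sign: "0 < (- 1) ^ j * poly q (l j)" if "j \<le> n" for j
  proof (cases j)
    case 0
    then show ?thesis using p_sign[of 0 0] pos by (simp add: q_eq l_def)
  next
    case (Suc m)
    then have "poly q (l j) = p (l j)"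
      using that by (simp add: q_eq l_def p_root)
    moreover have "0 < (- 1) ^ j * p (l j)"
    proof (rule p_sign[OF that])
      show "x i < l j" if "i < j" for i
        using gap'[of i m] that \<open>j \<le> n\<close> Suc by (simp add: l_def)
      show "l j < x i" if "j \<le> i" "i < n" for i
        using gap[of m i] that Suc by (simp add: l_def)
    qed
    ultimately show ?thesis by simp
  qed
  \<comment> \<open>At x_j the first term of \<open>q_eq\<close> vanishes and the second has the
    sign opposite to p(x_j - 1). By the gaps, x_j - 1 still exceeds all earlier roots, so q changes
    sign between l_j and x_j.\<close>
  have r_ex: "\<exists>r>l j. (- 1) ^ j * poly q r < 0 \<and> (j < n \<longrightarrow> r = x j)" if "j \<le> n" for j
  proof (cases "j < n")
    case True
    have "0 < (- 1) ^ j * p (x j - 1)"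
    proof (rule p_sign[OF that])
      show "x i < x j - 1" if "i < j" for i
        using gap[of i j] that True by simp
      show "x j - 1 < x i" if "j \<le> i" "i < n" for i
        using gap'[of j i] that by simp
    qed
    then have "0 < x j / a * ((- 1) ^ j * p (x j - 1))"
      using pos[OF True] assms by (metis divide_pos_pos mult_pos_pos)
    then have "(- 1) ^ j * poly q (x j) < 0"
      by (simp add: q_eq p_root True mult_ac)
    moreover have "l j < x j"
      using pos[OF True] gap[of "j - 1" j] True by (auto simp: l_def)
    ultimately show ?thesis by blast
  next
    case False
    with that have j: "j = n" by simp
    \<comment> \<open>The last interval is unbounded; the leading coefficient supplies the sign near
      infinity.\<close>
    have "lead_coeff q = (- 1 / a) ^ Suc n"
      using degree_lead_coeff_charlier[of a "Suc n"] assms unfolding q_def by blast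
    then have "lead_coeff (smult ((- 1) ^ Suc n) q) = (- 1) ^ Suc n * (- 1 / a) ^ Suc n"
      by (simp only: lead_coeff_smult)
    also have "\<dots> = (1 / a) ^ Suc n"
      by (simp only: power_mult_distrib[symmetric]) simp
    finally have "lead_coeff (smult ((- 1) ^ Suc n) q) = (1 / a) ^ Suc n" .
    then have lc: "0 < lead_coeff (smult ((- 1) ^ Suc n) q)"
      using assms by (simp del: lead_coeff_smult)
    obtain R where R: "\<And>t. t \<ge> R \<Longrightarrow> lead_coeff (smult ((- 1) ^ Suc n) q) \<le> poly (smult ((- 1) ^ Suc n) q) t"
      using poly_pinfty_gt_lc[OF lc] by blast
    \<comment> \<open>\<open>R\<close> may lie to the left of \<open>l n\<close>; the maximum keeps
      the witness inside the last interval.\<close>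
    have "0 < poly (smult ((- 1) ^ Suc n) q) (max R (l n + 1))"
      using lc R[of "max R (l n + 1)"] by linarith
    then show ?thesis
      using j by (intro exI[of _ "max R (l n + 1)"]) auto
  qed
  have "\<exists>z. l j < z \<and> (j < n \<longrightarrow> z < x j) \<and> poly q z = 0" if j: "j \<le> n" for j
  proof -
    obtain r where r: "l j < r" "(- 1) ^ j * poly q r < 0" "j < n \<longrightarrow> r = x j"
      using r_ex[OF j] by blast
    have "((- 1) ^ j * poly q (l j)) * ((- 1) ^ j * poly q r) < 0"
      using l_sign[OF j] r(2) by (rule mult_pos_neg)
    also have "((- 1) ^ j * poly q (l j)) * ((- 1) ^ j * poly q r) = poly q (l j) * poly q r"
      by (simp add: mult.assoc mult.left_commute)
    finally show ?thesis
      using poly_IVT[OF r(1)] r(3) by metis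
  qed
  then obtain z where z: "\<And>j. j \<le> n \<Longrightarrow> l j < z j" "\<And>j. j < n \<Longrightarrow> z j < x j"
      "\<And>j. j \<le> n \<Longrightarrow> poly q (z j) = 0"
    by (metis less_imp_le)
  have z_pos: "0 < z i" if "i < Suc n" for i
    using z(1)[of i] that pos[of "i - 1"] by (cases i) (auto simp: l_def)
  have z_gap: "z i + 1 < z j" if "i < j" "j < Suc n" for i j
  proof -
    have "z i + 1 < x i + 1" using z(2)[of i] that by simp
    also have "\<dots> \<le> x (j - 1) + 1" using gap'[of i "j - 1"] that by simp
    also have "\<dots> < z j" using z(1)[of j] that by (simp add: l_def)
    finally show ?thesis .
  qed
  have "inj_on z {..<Suc n}"
    by (rule linorder_inj_onI) (use z_gap in force)+
  then have "charlier (Suc n) a = (\<Prod>i<Suc n. [:z i / a, - 1 / a:])"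
    using assms z(3) by (intro charlier_eq_prod_roots) (auto simp: q_def)
  with z_pos z_gap show ?case by blast
qed simp

section \<open>Complex roots and multiplicities\<close>

lemma map_poly_of_real_mult:
  "map_poly of_real (p * q) = map_poly of_real p * map_poly of_real q"
  by (rule poly_eqI) (simp add: coeff_map_poly coeff_mult)

lemma map_poly_of_real_prod:
  "map_poly of_real (\<Prod>i\<in>A. f i) = (\<Prod>i\<in>A. map_poly of_real (f i))"
  by (induction A rule: infinite_finite_induct) (simp_all add: map_poly_of_real_mult)

text \<open>At x_j the other factors do not vanish, and its own factor is a nonzero multiple of t -
  x_j. The general field allows the use over the complex numbers, where simplicity is
  claimed.\<close>

lemma order_prod_linear:
  fixes x :: "nat \<Rightarrow> 'a::field"
  assumes "a \<noteq> 0" "inj_on x {..<n}" "j < n"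
  shows "order (x j) (\<Prod>i<n. [:x i / a, - 1 / a:]) = 1"
proof -
  let ?f = "\<lambda>i. [:x i / a, - 1 / a:]"
  have split: "(\<Prod>i<n. ?f i) = ?f j * (\<Prod>i\<in>{..<n} - {j}. ?f i)"
    using assms(3) by (intro prod.remove) auto
  have nz: "(\<Prod>i<n. ?f i) \<noteq> 0"
    using assms(1) by simp
  have "poly (?f i) (x j) \<noteq> 0" if "i \<in> {..<n} - {j}" for i
    using that assms inj_onD[OF assms(2), of i j] by (auto simp: field_simps)
  then have "order (x j) (\<Prod>i\<in>{..<n} - {j}. ?f i) = 0"
    by (intro order_0I) (simp add: poly_prod)
  moreover have "order (x j) (?f j) = 1"
  proof -
    have "?f j = smult (- 1 / a) ([:- x j, 1:] ^ 1)"
      by simp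
    then show ?thesis
      using assms(1) order_power_n_n[of "x j" 1] by (metis divide_eq_0_iff neg_equal_0_iff_equal one_neq_zero order_smult)
  qed
  ultimately show ?thesis
    unfolding split by (simp only: order_mult[OF nz[unfolded split]] add_0_right)
qed

section \<open>The energy\<close>

text \<open>By the mean value theorem the difference quotient is \<open>f'\<close> at a point
  strictly between x and y, and strict monotonicity compares it with \<open>f' x\<close>.\<close>

lemma strict_tangent_below:
  fixes f :: "real \<Rightarrow> real"
  assumes sub: "{min x y..max x y} \<subseteq> I" and "x \<noteq> y"
    and deriv: "\<And>z. z \<in> I \<Longrightarrow> (f has_real_derivative f' z) (at z)"
    and mono: "strict_mono_on I f'"
  shows "f x + f' x * (y - x) < f y"
proof (cases "x < y")
  case True
  then have "\<And>z. x \<le> z \<Longrightarrow> z \<le> y \<Longrightarrow> (f has_real_derivative f' z) (at z)"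
    using sub by (intro deriv) auto
  with True obtain z where z: "x < z" "z < y" "f y - f x = (y - x) * f' z"
    using MVT2[of x y f f'] by auto
  have "f' x < f' z"
    using z sub True by (intro strict_mono_onD[OF mono]) auto
  then have "(y - x) * f' x < (y - x) * f' z"
    using True by simp
  with z show ?thesis by (simp add: algebra_simps)
next
  case False
  with \<open>x \<noteq> y\<close> have "y < x" by simp
  then have "\<And>z. y \<le> z \<Longrightarrow> z \<le> x \<Longrightarrow> (f has_real_derivative f' z) (at z)"
    using sub by (intro deriv) auto
  with \<open>y < x\<close> obtain z where z: "y < z" "z < x" "f x - f y = (x - y) * f' z"
    using MVT2[of y x f f'] by auto
  have "f' z < f' x"
    using z sub \<open>y < x\<close> by (intro strict_mono_onD[OF mono]) auto
  then have "(x - y) * f' z < (x - y) * f' x"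
    using \<open>y < x\<close> by simp
  with z show ?thesis by (simp add: algebra_simps)
qed

lemma unit_potential_translate: "unit_potential x y = unit_potential 0 (y - x)"
  by (simp add: unit_potential_def)

text \<open>The derivative of \<open>unit_potential 0\<close> for |d| > 1: the rational terms from
  the two logarithms cancel.\<close>

definition unit_slope :: "real \<Rightarrow> real" where
  "unit_slope d = - 1 / 2 * ln ((d + 1) / (d - 1))"

lemma unit_ratio_pos: "\<bar>d\<bar> > 1 \<Longrightarrow> 0 < (d + 1) / (d - 1)" for d :: real
  by (cases "d > 0") (auto simp: zero_less_divide_iff)

lemma unit_slope_minus: "\<bar>d\<bar> > 1 \<Longrightarrow> unit_slope (- d) = - unit_slope d"
proof -
  assume "\<bar>d\<bar> > 1"
  have "(- d + 1) / (- d - 1) = inverse ((d + 1) / (d - 1))"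
    using minus_divide_divide[of "d - 1" "d + 1"] by simp
  then show ?thesis
    using unit_ratio_pos[OF \<open>\<bar>d\<bar> > 1\<close>] by (simp only: unit_slope_def ln_inverse)
qed

lemma unit_potential_has_derivative:
  assumes "\<bar>d\<bar> > 1"
  shows "(unit_potential 0 has_real_derivative unit_slope d) (at d)"
proof -
  have nz: "d + 1 \<noteq> 0" "d - 1 \<noteq> 0" using assms by auto
  have pos: "0 < (d + 1) / (d - 1)" by (rule unit_ratio_pos[OF assms])
  then have pos': "0 < (d + 1) * (d - 1)"
    by (simp add: zero_less_divide_iff zero_less_mult_iff)
  have ln1: "((\<lambda>d. ln ((d + 1) / (d - 1))) has_real_derivative - 2 / ((d - 1) * (d + 1))) (at d)"
    using pos nz by (auto intro!: derivative_eq_intros simp: divide_simps)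
  have ln2: "((\<lambda>d. ln ((d + 1) * (d - 1))) has_real_derivative 2 * d / ((d - 1) * (d + 1))) (at d)"
    using pos' nz by (auto intro!: derivative_eq_intros simp: divide_simps)
  have "((\<lambda>d. - d / 2) has_real_derivative - 1 / 2) (at d)"
    by (auto intro!: derivative_eq_intros)
  from DERIV_diff[OF DERIV_mult[OF this ln1] DERIV_cmult[OF ln2, of "1 / 2"]]
  show ?thesis
    unfolding unit_potential_def[abs_def] unit_slope_def by simp
qed

text \<open>(d + 1)/(d - 1) = 1 + 2/(d - 1) decreases on either half-line, though not across the
  excluded interval. Hence the potential is convex only while two charges keep their order.\<close>

lemma strict_mono_on_unit_slope:
  assumes "I = {1<..} \<or> I = {..< - 1}"
  shows "strict_mono_on I unit_slope"
proof (rule strict_mono_onI)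
  fix d e assume de: "d \<in> I" "e \<in> I" "d < e"
  then have *: "\<bar>d\<bar> > 1" "\<bar>e\<bar> > 1" "0 < (d - 1) * (e - 1)" "d \<noteq> 1" "e \<noteq> 1"
    using assms by (auto simp: zero_less_mult_iff)
  have "(d + 1) / (d - 1) - (e + 1) / (e - 1) = 2 * (e - d) / ((d - 1) * (e - 1))"
    using * by (simp add: field_simps)
  also have "\<dots> > 0"
    using * de(3) by simp
  finally show "unit_slope d < unit_slope e"
    using unit_ratio_pos[OF *(1)] unit_ratio_pos[OF *(2)] by (simp add: unit_slope_def)
qed

lemma unit_potential_tangent_below:
  assumes "1 < d \<and> 1 < e \<or> d < - 1 \<and> e < - 1"
  shows "unit_potential 0 d + unit_slope d * (e - d) \<le> unit_potential 0 e"
proof (cases "d = e")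
  case False
  define I where "I = (if d > 0 then {1<..} else {..< - 1 :: real})"
  have "unit_potential 0 d + unit_slope d * (e - d) < unit_potential 0 e"
    by (rule strict_tangent_below[of d e I])
      (use assms False in \<open>auto simp: I_def intro!: unit_potential_has_derivative
         strict_mono_on_unit_slope split: if_splits\<close>)
  then show ?thesis by simp
qed simp

section \<open>First variation and strict minimality\<close>

definition pairs :: "nat \<Rightarrow> (nat \<times> nat) set" where
  "pairs n = (SIGMA j:{..<n}. {..<n} - {j})"

lemma sum_pairs: "(\<Sum>(j, k)\<in>pairs n. f j k) = (\<Sum>j<n. \<Sum>k\<in>{..<n} - {j}. f j k)"
  unfolding pairs_def by (rule sum.Sigma[symmetric]) auto

lemma sum_pairs_swap: "(\<Sum>(j, k)\<in>pairs n. f j k) = (\<Sum>(j, k)\<in>pairs n. f k j)"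
  by (rule sum.reindex_bij_witness[of _ "\<lambda>(j, k). (k, j)" "\<lambda>(j, k). (k, j)"])
    (auto simp: pairs_def)

lemma energy_eq_pairs:
  assumes "length xs = n"
  shows "energy \<phi> xs
     = (\<Sum>(j, k)\<in>pairs n. unit_potential 0 (xs ! j - xs ! k)) + 2 * (\<Sum>j<n. \<phi> (xs ! j))"
proof -
  have "{(j, k). j < length xs \<and> k < length xs \<and> j \<noteq> k} = pairs n"
    using assms by (auto simp: pairs_def)
  then show ?thesis
    using assms unfolding energy_def by (simp add: unit_potential_translate[of "xs ! _" "xs ! _"])
qed

text \<open>By oddness of \<open>unit_slope\<close>, the first-order variation of the interaction energy
  collects into one force per charge.\<close>

lemma sum_pairs_unit_slope:
  assumes "\<And>j k. j < n \<Longrightarrow> k < n \<Longrightarrow> j \<noteq> k \<Longrightarrow> \<bar>x j - x k\<bar> > 1"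
  shows "(\<Sum>(j, k)\<in>pairs n. unit_slope (x j - x k) * (\<delta> j - \<delta> k))
     = 2 * (\<Sum>j<n. \<delta> j * (\<Sum>k\<in>{..<n} - {j}. unit_slope (x j - x k)))"
proof -
  let ?s = "\<lambda>j k. unit_slope (x j - x k)"
  have "(\<Sum>(j, k)\<in>pairs n. ?s j k * \<delta> k) = (\<Sum>(j, k)\<in>pairs n. ?s k j * \<delta> j)"
    by (rule sum_pairs_swap)
  also have "\<dots> = (\<Sum>(j, k)\<in>pairs n. - (?s j k * \<delta> j))"
  proof (rule sum.cong, simp, clarify)
    fix j k assume "(j, k) \<in> pairs n"
    then show "?s k j * \<delta> j = - (?s j k * \<delta> j)"
      using unit_slope_minus[OF assms[of j k]] by (simp add: pairs_def)
  qed
  finally have swap: "(\<Sum>(j, k)\<in>pairs n. ?s j k * \<delta> k) = - (\<Sum>(j, k)\<in>pairs n. ?s j k * \<delta> j)"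
    by (simp add: sum_negf case_prod_unfold)
  have "(\<Sum>(j, k)\<in>pairs n. ?s j k * (\<delta> j - \<delta> k))
      = (\<Sum>(j, k)\<in>pairs n. ?s j k * \<delta> j) - (\<Sum>(j, k)\<in>pairs n. ?s j k * \<delta> k)"
    by (simp add: case_prod_unfold right_diff_distrib sum_subtractf)
  also have "\<dots> = 2 * (\<Sum>(j, k)\<in>pairs n. ?s j k * \<delta> j)"
    unfolding swap by simp
  also have "\<dots> = 2 * (\<Sum>j<n. \<delta> j * (\<Sum>k\<in>{..<n} - {j}. ?s j k))"
    by (simp add: sum_pairs sum_distrib_left mult.commute)
  finally show ?thesis .
qed

text \<open>Tangent inequalities for all pairs and for the field are added. The interaction gives
  only a weak inequality, since a common translation leaves it unchanged; strictness comes from the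
  field, whose derivative ln(x/a)/2 is strictly increasing.\<close>

lemma energy_strict_minimum:
  assumes "a > 0"
    and \<phi>: "\<And>x. x > 0 \<Longrightarrow> (\<phi> has_real_derivative - (1 / 2 * ln (a / x))) (at x)"
    and len: "length xs = n" "length ys = n"
    and pos: "\<And>j. j < n \<Longrightarrow> 0 < xs ! j" "\<And>j. j < n \<Longrightarrow> 0 < ys ! j"
    and gap: "\<And>j k. j < k \<Longrightarrow> k < n \<Longrightarrow> xs ! j + 1 < xs ! k"
             "\<And>j k. j < k \<Longrightarrow> k < n \<Longrightarrow> ys ! j + 1 < ys ! k"
    and critical: "\<And>j. j < n \<Longrightarrow>
       (\<Sum>k\<in>{..<n} - {j}. unit_slope (xs ! j - xs ! k)) = 1 / 2 * ln (a / xs ! j)"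
    and "xs \<noteq> ys"
  shows "energy \<phi> xs < energy \<phi> ys"
proof -
  let ?x = "\<lambda>j. xs ! j" and ?y = "\<lambda>j. ys ! j"
  let ?\<delta> = "\<lambda>j. ?y j - ?x j"
  let ?V = "unit_potential 0"
  have sep: "\<bar>?x j - ?x k\<bar> > 1" if "j < n" "k < n" "j \<noteq> k" for j k
    using gap(1)[of j k] gap(1)[of k j] that by (cases j k rule: linorder_cases) auto
  have "(\<Sum>(j, k)\<in>pairs n. ?V (?x j - ?x k) + unit_slope (?x j - ?x k) * (?\<delta> j - ?\<delta> k))
      \<le> (\<Sum>(j, k)\<in>pairs n. ?V (?y j - ?y k))"
  proof (rule sum_mono, clarify)
    fix j k assume "(j, k) \<in> pairs n"
    then have jk: "j < n" "k < n" "j \<noteq> k" by (auto simp: pairs_def)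
    \<comment> \<open>Both configurations are increasing, so the two differences lie on the same
      side of the excluded interval.\<close>
    have "?V (?x j - ?x k) + unit_slope (?x j - ?x k) * ((?y j - ?y k) - (?x j - ?x k))
        \<le> ?V (?y j - ?y k)"
      using jk gap[of j k] gap[of k j]
      by (intro unit_potential_tangent_below) (cases j k rule: linorder_cases, auto)
    then show "?V (?x j - ?x k) + unit_slope (?x j - ?x k) * (?\<delta> j - ?\<delta> k) \<le> ?V (?y j - ?y k)"
      by (simp add: algebra_simps)
  qed
  then have "(\<Sum>(j, k)\<in>pairs n. ?V (?x j - ?x k))
      + (\<Sum>(j, k)\<in>pairs n. unit_slope (?x j - ?x k) * (?\<delta> j - ?\<delta> k))
      \<le> (\<Sum>(j, k)\<in>pairs n. ?V (?y j - ?y k))"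
    by (simp add: case_prod_unfold sum.distrib)
  moreover have "(\<Sum>(j, k)\<in>pairs n. unit_slope (?x j - ?x k) * (?\<delta> j - ?\<delta> k))
      = 2 * (\<Sum>j<n. ?\<delta> j * (1 / 2 * ln (a / ?x j)))"
    by (subst sum_pairs_unit_slope) (simp_all add: sep critical)
  moreover have "(\<Sum>j<n. \<phi> (?x j) + - (1 / 2 * ln (a / ?x j)) * ?\<delta> j) < (\<Sum>j<n. \<phi> (?y j))"
  proof -
    have strict: "\<phi> u + - (1 / 2 * ln (a / u)) * (v - u) < \<phi> v" if "0 < u" "0 < v" "u \<noteq> v" for u v
    proof (rule strict_tangent_below[where I = "{0<..}"])
      show "strict_mono_on {0<..} (\<lambda>u. - (1 / 2 * ln (a / u)))"
        using \<open>a > 0\<close> by (auto intro!: strict_mono_onI simp: divide_strict_left_mono)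
    qed (use that \<phi> in auto)
    obtain j where j: "j < n" "?x j \<noteq> ?y j"
      using \<open>xs \<noteq> ys\<close> len by (auto simp: list_eq_iff_nth_eq)
    show ?thesis
    proof (rule sum_strict_mono_ex1)
      show "\<forall>j\<in>{..<n}. \<phi> (?x j) + - (1 / 2 * ln (a / ?x j)) * ?\<delta> j \<le> \<phi> (?y j)"
      proof
        fix j assume "j \<in> {..<n}"
        then show "\<phi> (?x j) + - (1 / 2 * ln (a / ?x j)) * ?\<delta> j \<le> \<phi> (?y j)"
          using strict[of "?x j" "?y j"] pos[of j] by (cases "?x j = ?y j") auto
      qed
      show "\<exists>j\<in>{..<n}. \<phi> (?x j) + - (1 / 2 * ln (a / ?x j)) * ?\<delta> j < \<phi> (?y j)"
        using j pos strict by blast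
    qed simp
  qed
  then have "(\<Sum>j<n. \<phi> (?x j)) - (\<Sum>j<n. ?\<delta> j * (1 / 2 * ln (a / ?x j))) < (\<Sum>j<n. \<phi> (?y j))"
    by (simp add: sum.distrib sum_subtractf mult.commute)
  \<comment> \<open>The linear terms cancel: the pairs contribute twice the sum of displacement
    times ln(a/x_j)/2, and the doubled field term contributes its negative.\<close>
  ultimately show ?thesis
    unfolding energy_eq_pairs[OF len(1)] energy_eq_pairs[OF len(2)] by linarith
qed

section \<open>Independence of the labelling\<close>

text \<open>Expressed through the set of entries, the energy is visibly invariant under
  permutation.\<close>

lemma energy_distinct:
  assumes "distinct xs"
  shows "energy \<phi> xs = (\<Sum>(u, v)\<in>{(u, v). u \<in> set xs \<and> v \<in> set xs \<and> u \<noteq> v}. unit_potential v u)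
     + 2 * sum \<phi> (set xs)"
proof -
  have bij: "bij_betw ((!) xs) {..<length xs} (set xs)"
    by (rule bij_betw_nth[OF assms]) auto
  have "(\<Sum>j<length xs. \<phi> (xs ! j)) = sum \<phi> (set xs)"
    by (rule sum.reindex_bij_betw[OF bij])
  moreover have "bij_betw (map_prod ((!) xs) ((!) xs))
      {(j, k). j < length xs \<and> k < length xs \<and> j \<noteq> k}
      {(u, v). u \<in> set xs \<and> v \<in> set xs \<and> u \<noteq> v}"
    unfolding bij_betw_def
  proof
    show "inj_on (map_prod ((!) xs) ((!) xs)) {(j, k). j < length xs \<and> k < length xs \<and> j \<noteq> k}"
      using assms by (auto simp: inj_on_def nth_eq_iff_index_eq)
    show "map_prod ((!) xs) ((!) xs) ` {(j, k). j < length xs \<and> k < length xs \<and> j \<noteq> k}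
      = {(u, v). u \<in> set xs \<and> v \<in> set xs \<and> u \<noteq> v}"
      using assms by (force simp: in_set_conv_nth image_iff nth_eq_iff_index_eq)
  qed
  from sum.reindex_bij_betw[OF this, of "\<lambda>(u, v). unit_potential v u"]
  have "(\<Sum>(j, k)\<in>{(j, k). j < length xs \<and> k < length xs \<and> j \<noteq> k}. unit_potential (xs ! k) (xs ! j))
      = (\<Sum>(u, v)\<in>{(u, v). u \<in> set xs \<and> v \<in> set xs \<and> u \<noteq> v}. unit_potential v u)"
    by (simp add: case_prod_unfold)
  ultimately show ?thesis
    unfolding energy_def by simp
qed

lemma admissible_distinct: "admissible I n xs \<Longrightarrow> distinct xs"
  by (force simp: admissible_def distinct_conv_nth)

lemma admissible_iff_set:
  "admissible I n xs \<longleftrightarrow> length xs = n \<and> distinct xs \<and> set xs \<subseteq> I \<and>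
     (\<forall>u\<in>set xs. \<forall>v\<in>set xs. u \<noteq> v \<longrightarrow> \<bar>u - v\<bar> > 1)"
proof (intro iffI conjI)
  assume "admissible I n xs"
  then show "distinct xs" "length xs = n" "set xs \<subseteq> I"
    using admissible_distinct by (auto simp: admissible_def)
  show "\<forall>u\<in>set xs. \<forall>v\<in>set xs. u \<noteq> v \<longrightarrow> \<bar>u - v\<bar> > 1"
  proof (intro ballI impI)
    fix u v assume "u \<in> set xs" "v \<in> set xs" "u \<noteq> v"
    then obtain j k where "j < n" "k < n" "j \<noteq> k" "u = xs ! j" "v = xs ! k"
      using \<open>length xs = n\<close> by (metis in_set_conv_nth)
    with \<open>admissible I n xs\<close> show "\<bar>u - v\<bar> > 1"
      by (simp add: admissible_def)
  qed
next
  assume "length xs = n \<and> distinct xs \<and> set xs \<subseteq> I \<and>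
     (\<forall>u\<in>set xs. \<forall>v\<in>set xs. u \<noteq> v \<longrightarrow> \<bar>u - v\<bar> > 1)"
  then show "admissible I n xs"
    by (auto simp: admissible_def nth_eq_iff_index_eq)
qed

text \<open>Reduces arbitrary competitors to increasing ones, the only ones to which the convexity
  argument applies.\<close>

lemma admissible_sort:
  assumes "admissible I n xs"
  shows "admissible I n (sort xs)" and "energy \<phi> (sort xs) = energy \<phi> xs"
    and "\<And>j k. j < k \<Longrightarrow> k < n \<Longrightarrow> sort xs ! j + 1 < sort xs ! k"
proof -
  have dist: "distinct xs"
    by (rule admissible_distinct[OF assms])
  show adm: "admissible I n (sort xs)"
    using assms unfolding admissible_iff_set by simp
  show "energy \<phi> (sort xs) = energy \<phi> xs"
    using dist by (simp add: energy_distinct)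
  fix j k assume jk: "j < k" "k < n"
  then have "sort xs ! j \<le> sort xs ! k"
    using adm by (intro sorted_nth_mono) (auto simp: admissible_def)
  moreover have "\<bar>sort xs ! j - sort xs ! k\<bar> > 1"
    using adm jk by (auto simp: admissible_def)
  ultimately show "sort xs ! j + 1 < sort xs ! k"
    by linarith
qed

section \<open>Equilibrium equations at the roots\<close>

lemma charlier_roots_critical:
  assumes "a > 0" "\<And>i. i < n \<Longrightarrow> 0 < x i"
    and sep: "\<And>j k. j < n \<Longrightarrow> k < n \<Longrightarrow> j \<noteq> k \<Longrightarrow> \<bar>x j - x k\<bar> > 1"
    and prod: "charlier n a = (\<Prod>i<n. [:x i / a, - 1 / a:])"
    and j: "j < n"
  shows "(\<Sum>k\<in>{..<n} - {j}. unit_slope (x j - x k)) = 1 / 2 * ln (a / x j)"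
proof -
  let ?K = "{..<n} - {j}"
  have split: "poly (charlier n a) t = (x j - t) / a * (\<Prod>k\<in>?K. (x k - t) / a)" for t
    unfolding prod poly_prod using j
    by (subst prod.remove[of _ j]) (auto simp: diff_divide_distrib)
  have "a * poly (charlier n a) (x j + 1) + x j * poly (charlier n a) (x j - 1) = 0"
    using charlier_difference_equation[of a n "x j"] split[of "x j"] assms(1) by simp
  \<comment> \<open>The factor belonging to x_j itself equals -1/a at x_j + 1 and 1/a at x_j - 1;
    removing it turns the vanishing sum into an equality of products.\<close>
  then have eq: "a * (\<Prod>k\<in>?K. (x k - (x j + 1)) / a) = x j * (\<Prod>k\<in>?K. (x k - (x j - 1)) / a)"
    unfolding split using assms(1) by (simp add: field_simps)
  have nz: "(\<Prod>k\<in>?K. (x k - (x j - 1)) / a) \<noteq> 0"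
    using sep[OF j] assms(1) by fastforce
  have "(\<Prod>k\<in>?K. (x j - x k + 1) / (x j - x k - 1))
      = (\<Prod>k\<in>?K. (x k - (x j + 1)) / a / ((x k - (x j - 1)) / a))"
  proof (rule prod.cong)
    fix k
    have "(x k - (x j + 1)) / a / ((x k - (x j - 1)) / a) = (x k - (x j + 1)) / (x k - (x j - 1))"
      using assms(1) by simp
    also have "\<dots> = (x j - x k + 1) / (x j - x k - 1)"
      using minus_divide_divide[of "x j - x k + 1" "x j - x k - 1"] by (simp add: algebra_simps)
    finally show "(x j - x k + 1) / (x j - x k - 1)
        = (x k - (x j + 1)) / a / ((x k - (x j - 1)) / a)" ..
  qed simp
  also have "\<dots> = x j / a"
    using eq nz assms(1) by (simp only: prod_dividef[of "\<lambda>k. (x k - (x j + 1)) / a"]) (simp add: field_simps)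
  finally have ratio: "(\<Prod>k\<in>?K. (x j - x k + 1) / (x j - x k - 1)) = x j / a" .
  \<comment> \<open>Separation makes every ratio positive, so the logarithm of the product identity
    is the force balance at x_j.\<close>
  have "(\<Sum>k\<in>?K. ln ((x j - x k + 1) / (x j - x k - 1)))
      = ln (\<Prod>k\<in>?K. (x j - x k + 1) / (x j - x k - 1))"
  proof (rule ln_prod[symmetric])
    fix k assume "k \<in> ?K"
    then have "0 < (x j - x k + 1) / (x j - x k - 1)"
      using sep[OF j, of k] by (intro unit_ratio_pos) auto
    then show "(x j - x k + 1) / (x j - x k - 1) \<noteq> 0"
      by (rule less_imp_neq[symmetric])
  qed simp
  also have "\<dots> = - ln (a / x j)"
    using assms(1) assms(2)[OF j] by (simp add: ratio ln_div)
  finally show ?thesis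
    unfolding unit_slope_def sum_distrib_left[symmetric] by simp
qed

text \<open>Passing to complex coefficients makes the reality of all roots a genuine claim, and the
  equivalence for \<open>xs\<close> includes uniqueness. The field enters through its derivative
  only, so an additive constant in \<open>\<phi>\<close> is immaterial.\<close>

theorem mainTheorem7:
  fixes a :: real and n :: nat and \<phi> :: "real \<Rightarrow> real"
  assumes "a > 0" and "n \<ge> 1"
    and "\<And>x. x > 0 \<Longrightarrow> (\<phi> has_real_derivative - (1 / 2 * ln (a / x))) (at x)"
  shows "(\<forall>z::complex. poly (map_poly complex_of_real (charlier n a)) z = 0 \<longrightarrow>
            z \<in> \<real> \<and> order z (map_poly complex_of_real (charlier n a)) = 1)
       \<and> {x. poly (charlier n a) x = 0} \<subseteq> {0<..}
       \<and> (\<forall>x y. poly (charlier n a) x = 0 \<longrightarrow> poly (charlier n a) y = 0 \<longrightarrow> x \<noteq> y \<longrightarrow>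
            \<bar>x - y\<bar> > 1)
       \<and> (\<forall>xs. equilibrium_distribution \<phi> {0<..} n xs \<longleftrightarrow>
            xs = sorted_list_of_set {x. poly (charlier n a) x = 0})"
proof -
  obtain x where pos: "\<And>i. i < n \<Longrightarrow> 0 < x i"
    and gap: "\<And>i j. i < j \<Longrightarrow> j < n \<Longrightarrow> x i + 1 < x j"
    and prod: "charlier n a = (\<Prod>i<n. [:x i / a, - 1 / a:])"
    using charlier_roots[OF \<open>a > 0\<close>, of n] by blast
  have inj: "inj_on x {..<n}"
    by (rule linorder_inj_onI) (use gap in force)+
  have sep: "\<bar>x j - x k\<bar> > 1" if "j < n" "k < n" "j \<noteq> k" for j k
    using gap[of j k] gap[of k j] that by (cases j k rule: linorder_cases) auto
  have roots: "{t. poly (charlier n a) t = 0} = x ` {..<n}"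
    using \<open>a > 0\<close> unfolding prod poly_prod by (auto simp: field_simps)
  define zs where "zs = map x [0..<n]"
  have zs: "length zs = n" "set zs = x ` {..<n}" "\<And>j. j < n \<Longrightarrow> zs ! j = x j"
    by (auto simp: zs_def)
  have "sorted_wrt (<) zs"
    using gap by (force simp: sorted_wrt_iff_nth_less zs)
  then have zs_roots: "sorted_list_of_set {t. poly (charlier n a) t = 0} = zs"
    unfolding roots zs(2)[symmetric]
    by (simp add: strict_sorted_iff sorted_list_of_set.idem_if_sorted_distinct)

  have "z \<in> \<real> \<and> order z (map_poly complex_of_real (charlier n a)) = 1"
    if "poly (map_poly complex_of_real (charlier n a)) z = 0" for z
  proof -
    let ?x = "\<lambda>i. complex_of_real (x i)"
    have eq: "map_poly complex_of_real (charlier n a)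
        = (\<Prod>i<n. [:?x i / of_real a, - 1 / of_real a:])"
      unfolding prod map_poly_of_real_prod by (rule prod.cong) (auto simp: map_poly_pCons)
    with that \<open>a > 0\<close> obtain j where "j < n" "z = ?x j"
      by (auto simp: poly_prod field_simps)
    moreover have "inj_on ?x {..<n}"
      using inj by (auto simp: inj_on_def)
    ultimately show ?thesis
      unfolding eq using order_prod_linear[of "complex_of_real a" ?x n j] \<open>a > 0\<close> by simp
  qed
  moreover have "{t. poly (charlier n a) t = 0} \<subseteq> {0<..}"
    unfolding roots using pos by auto
  moreover have "\<bar>u - v\<bar> > 1"
    if "poly (charlier n a) u = 0" "poly (charlier n a) v = 0" "u \<noteq> v" for u v
  proof -
    from that(1,2) have "u \<in> x ` {..<n}" "v \<in> x ` {..<n}"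
      unfolding roots[symmetric] by auto
    with that(3) sep show ?thesis by auto
  qed
  moreover have "equilibrium_distribution \<phi> {0<..} n xs \<longleftrightarrow> xs = zs" for xs
  proof -
    have zs_adm: "admissible {0<..} n zs"
      using pos sep by (auto simp: admissible_def zs)
    have min: "energy \<phi> zs < energy \<phi> ys"
      if "admissible {0<..} n ys" "\<And>j k. j < k \<Longrightarrow> k < n \<Longrightarrow> ys ! j + 1 < ys ! k" "ys \<noteq> zs" for ys
    proof (rule energy_strict_minimum[OF \<open>a > 0\<close> assms(3) zs(1)])
      show "(\<Sum>k\<in>{..<n} - {j}. unit_slope (zs ! j - zs ! k)) = 1 / 2 * ln (a / zs ! j)"
        if "j < n" for j
        using charlier_roots_critical[OF \<open>a > 0\<close> pos sep prod that] that by (simp add: zs)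
      show "0 < ys ! j" if "j < n" for j
        using \<open>admissible {0<..} n ys\<close> that
        by (metis admissible_def greaterThan_iff nth_mem subsetD)
    qed (use that pos gap in \<open>auto simp: admissible_def zs\<close>)
    \<comment> \<open>Sorting a competitor keeps its energy, so the minimum over increasing lists
      bounds all admissible ones.\<close>
    have "energy \<phi> zs \<le> energy \<phi> ys" if "admissible {0<..} n ys" for ys
      using min[of "sort ys"] admissible_sort[OF that] by (metis less_imp_le order_refl)
    then have "equilibrium_distribution \<phi> {0<..} n zs"
      using zs_adm gap by (auto simp: equilibrium_distribution_def zs)
    moreover have "xs = zs" if eq: "equilibrium_distribution \<phi> {0<..} n xs"
    proof (rule ccontr)
      assume "xs \<noteq> zs"
      have adm: "admissible {0<..} n xs" and le: "energy \<phi> xs \<le> energy \<phi> zs"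
        using eq zs_adm by (auto simp: equilibrium_distribution_def)
      \<comment> \<open>An equilibrium is increasing by its gap condition, so it equals its sorted
        version and strict minimality applies to it directly.\<close>
      have "\<forall>j. Suc j < length xs \<longrightarrow> xs ! j < xs ! Suc j"
        using eq by (force simp: equilibrium_distribution_def admissible_def)
      then have "sorted_wrt (<) xs"
        by (simp add: sorted_wrt_iff_nth_Suc_transp)
      then have "sort xs = xs"
        by (simp add: strict_sorted_imp_sorted sorted_sort_id)
      then have "energy \<phi> zs < energy \<phi> xs"
        using min[OF adm] admissible_sort(3)[OF adm] \<open>xs \<noteq> zs\<close> by simp
      with le show False by simp
    qed
    ultimately show ?thesis by blast
  qed
  ultimately show ?thesis
    unfolding zs_roots by blast
qed

end
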